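(* Let $h:M^m\to\mathbb R^n$ be a substantial $C^2$ isometric immersion of a compact $m$-dimensional Riemannian manifold $M^m$, and let $H_1,\dots,H_s$ be supporting hyperplanes of $\operatorname{Conv}[h(M^m)]$ in general position that pass through a point $p_o$ of the boundary of $\operatorname{Conv}[h(M^m)]$. For $i=1,\dots,s$ let $e_i\in[H_i]^{\perp}$ be the unit vector such that $\langle h(x)-p_o,e_i\rangle\ge 0$ for every $x\in M^m$. Then $s\le n-m$, $h(M)\cap H_1\cap\dots\cap H_s\ne\emptyset$, and for every point $q\in M^m$ such that $h(q)\in H_1\cap\dots\cap H_s$ one has $\left\langle\overrightarrow H(q),e_i\right\rangle\ge 0$, $i=1,\dots,s$.
   Context: Manifolds are connected and without boundary. $\operatorname{Conv}(A)$ denotes the convex hull of $A\subset\mathbb R^n$, and its boundary is its topological boundary in $\mathbb R^n$. The map $h$ is substantial if $h(M)$ is not contained in a proper affine subspace of $\mathbb R^n$. A supporting hyperplane of $C=\operatorname{Conv}[h(M)]$ at a boundary point $p_o$ is an affine hyperplane through $p_o$ such that $C$ is contained in one of the two closed half-spaces it bounds; $[H_i]^{\perp}$ is the line of vectors normal to $H_i$. Hyperplanes through $p_o$ are in general position if their unit normal vectors are linearly independent. With $\sigma$ the vector-valued second fundamental form of $h$, the mean curvature vector field of $h$ is $\overrightarrow H=\frac1m\operatorname{trace}\sigma$. *)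

theory Defs
  imports "HOL-Analysis.Analysis" "HOL-Library.Extended_Nat"
begin

section \<open>Maps of class \<open>C\<^sup>k\<close> on an open set\<close>

text \<open>The derivative of order \<open>k\<close> is taken along fixed directions; in finite dimension this is
  equivalent to continuity of the \<open>k\<close>-th Frechet derivative. Meant for open \<open>S\<close>.\<close>

primrec Ck_on_nat :: "nat \<Rightarrow> ('a::euclidean_space \<Rightarrow> 'b::euclidean_space) \<Rightarrow> 'a set \<Rightarrow> bool" where
  "Ck_on_nat 0 f S \<longleftrightarrow> continuous_on S f"
| "Ck_on_nat (Suc k) f S \<longleftrightarrow>
     (\<forall>x\<in>S. f differentiable (at x)) \<and>
     (\<forall>v. Ck_on_nat k (\<lambda>x. frechet_derivative f (at x) v) S)"

definition Ck_on :: "enat \<Rightarrow> ('a::euclidean_space \<Rightarrow> 'b::euclidean_space) \<Rightarrow> 'a set \<Rightarrow> bool" where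
  "Ck_on k f S \<longleftrightarrow> (\<forall>j. enat j \<le> k \<longrightarrow> Ck_on_nat j f S)"


section \<open>Manifolds and Riemannian metrics\<close>

text \<open>A chart is a domain together with a coordinate map; only the values of the coordinate map
  on the domain matter.\<close>

type_synonym ('a, 'm) chart = "'a set \<times> ('a \<Rightarrow> real ^ 'm)"

abbreviation chart_inv :: "('a, 'm::finite) chart \<Rightarrow> real ^ 'm \<Rightarrow> 'a" where
  "chart_inv c \<equiv> inv_into (fst c) (snd c)"

definition is_chart :: "'a topology \<Rightarrow> ('a, 'm::finite) chart \<Rightarrow> bool" where
  "is_chart M c \<longleftrightarrow> openin M (fst c) \<and> open (snd c ` fst c) \<and>
     homeomorphic_map (subtopology M (fst c)) (top_of_set (snd c ` fst c)) (snd c)"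

text \<open>Connected manifold without boundary, of class \<open>C\<^sup>k\<close> (\<open>k = \<infinity>\<close> is the smooth case), of dimension
  \<open>CARD('m)\<close>. The atlas need not be maximal.\<close>

definition manifold :: "enat \<Rightarrow> 'a topology \<Rightarrow> ('a, 'm::finite) chart set \<Rightarrow> bool" where
  "manifold k M A \<longleftrightarrow>
     topspace M \<noteq> {} \<and> Hausdorff_space M \<and> second_countable M \<and> connected_space M \<and>
     (\<forall>c\<in>A. is_chart M c) \<and> (\<Union>c\<in>A. fst c) = topspace M \<and>
     (\<forall>c\<in>A. \<forall>d\<in>A. Ck_on k (snd d \<circ> chart_inv c) (snd c ` (fst c \<inter> fst d)))"

text \<open>A tangent vector at \<open>p\<close> is represented by its components in a chart around \<open>p\<close>; passing
  from the chart \<open>c\<close> to the chart \<open>d\<close>, components transform by the differential of the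
  coordinate change. Accordingly \<open>g c p u v\<close> is the scalar product of the two tangent vectors at
  \<open>p\<close> with components \<open>u\<close>, \<open>v\<close> in \<open>c\<close>.\<close>

type_synonym ('a, 'm) metric_tensor =
  "('a, 'm) chart \<Rightarrow> 'a \<Rightarrow> real ^ 'm \<Rightarrow> real ^ 'm \<Rightarrow> real"

definition coord_change ::
  "('a, 'm::finite) chart \<Rightarrow> ('a, 'm) chart \<Rightarrow> 'a \<Rightarrow> real ^ 'm \<Rightarrow> real ^ 'm" where
  "coord_change c d p = frechet_derivative (snd d \<circ> chart_inv c) (at (snd c p))"

definition riemannian_metric ::
  "enat \<Rightarrow> ('a, 'm::finite) chart set \<Rightarrow> ('a, 'm) metric_tensor \<Rightarrow> bool" where
  "riemannian_metric r A g \<longleftrightarrow>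
     (\<forall>c\<in>A. \<forall>p\<in>fst c. bilinear (g c p) \<and> (\<forall>u v. g c p u v = g c p v u) \<and>
        (\<forall>u. u \<noteq> 0 \<longrightarrow> g c p u u > 0)) \<and>
     (\<forall>c\<in>A. \<forall>d\<in>A. \<forall>p\<in>fst c \<inter> fst d. \<forall>u v.
        g d p (coord_change c d p u) (coord_change c d p v) = g c p u v) \<and>
     (\<forall>c\<in>A. \<forall>u v. Ck_on r (\<lambda>x. g c (chart_inv c x) u v) (snd c ` fst c))"

text \<open>With a \<open>C\<^sup>k\<close> atlas the components of a metric tensor can be at most \<open>C\<^sup>k\<^sup>-\<^sup>1\<close>; note
  \<open>\<infinity> - 1 = \<infinity>\<close>.\<close>

definition riemannian_manifold ::
  "enat \<Rightarrow> 'a topology \<Rightarrow> ('a, 'm::finite) chart set \<Rightarrow> ('a, 'm) metric_tensor \<Rightarrow> bool" where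
  "riemannian_manifold k M A g \<longleftrightarrow> manifold k M A \<and> riemannian_metric (k - 1) A g"


section \<open>Isometric immersions into Euclidean space and their curvature\<close>

definition differential ::
  "('a, 'm::finite) chart \<Rightarrow> ('a \<Rightarrow> real ^ 'n::finite) \<Rightarrow> 'a \<Rightarrow> real ^ 'm \<Rightarrow> real ^ 'n" where
  "differential c h p = frechet_derivative (h \<circ> chart_inv c) (at (snd c p))"

definition Ck_map :: "enat \<Rightarrow> ('a, 'm::finite) chart set \<Rightarrow> ('a \<Rightarrow> real ^ 'n::finite) \<Rightarrow> bool" where
  "Ck_map k A h \<longleftrightarrow> (\<forall>c\<in>A. Ck_on k (h \<circ> chart_inv c) (snd c ` fst c))"

definition immersion :: "('a, 'm::finite) chart set \<Rightarrow> ('a \<Rightarrow> real ^ 'n::finite) \<Rightarrow> bool" where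
  "immersion A h \<longleftrightarrow> (\<forall>c\<in>A. \<forall>p\<in>fst c. inj (differential c h p))"

definition isometric ::
  "('a, 'm::finite) chart set \<Rightarrow> ('a, 'm) metric_tensor \<Rightarrow> ('a \<Rightarrow> real ^ 'n::finite) \<Rightarrow> bool" where
  "isometric A g h \<longleftrightarrow>
     (\<forall>c\<in>A. \<forall>p\<in>fst c. \<forall>u v. differential c h p u \<bullet> differential c h p v = g c p u v)"

definition normal_component :: "(real ^ 'n::finite) set \<Rightarrow> real ^ 'n \<Rightarrow> real ^ 'n" where
  "normal_component T w = (THE z. z \<in> orthogonal_comp T \<and> w - z \<in> T)"

text \<open>\<open>\<sigma>(U, V)\<close> is the normal component of the Euclidean derivative of \<open>dh(V)\<close> in the
  direction \<open>U\<close>, where \<open>V\<close> is any vector field extending \<open>v\<close>. Here \<open>V\<close> is the field with constant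
  components \<open>v\<close> in the chart \<open>c\<close>.\<close>

definition second_fundamental_form ::
  "('a, 'm::finite) chart \<Rightarrow> ('a \<Rightarrow> real ^ 'n::finite) \<Rightarrow> 'a \<Rightarrow> real ^ 'm \<Rightarrow> real ^ 'm \<Rightarrow> real ^ 'n"
where
  "second_fundamental_form c h p u v =
     normal_component (range (differential c h p))
       (frechet_derivative (\<lambda>x. frechet_derivative (h \<circ> chart_inv c) (at x) v) (at (snd c p)) u)"

text \<open>The trace \<open>g\<^sup>i\<^sup>j B(\<partial>\<^sub>i, \<partial>\<^sub>j)\<close> of a bilinear form on \<open>\<real>\<^sup>m\<close> with respect to a scalar
  product \<open>G\<close>; equivalently the sum of \<open>B(E\<^sub>i, E\<^sub>i)\<close> over a \<open>G\<close>-orthonormal basis.\<close>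

definition metric_trace ::
  "(real ^ 'm::finite \<Rightarrow> real ^ 'm \<Rightarrow> real) \<Rightarrow>
   (real ^ 'm \<Rightarrow> real ^ 'm \<Rightarrow> real ^ 'n::finite) \<Rightarrow> real ^ 'n" where
  "metric_trace G B =
     (\<Sum>i\<in>UNIV. \<Sum>j\<in>UNIV.
        (matrix_inv (\<chi> k l. G (axis k 1) (axis l 1)) $ i $ j) *\<^sub>R B (axis i 1) (axis j 1))"

text \<open>As the normal component of an ambient derivative, the value does not depend on the
  chart \<open>c\<close> around \<open>p\<close> in which it is computed.\<close>

definition mean_curvature ::
  "('a, 'm::finite) chart \<Rightarrow> ('a, 'm) metric_tensor \<Rightarrow> ('a \<Rightarrow> real ^ 'n::finite) \<Rightarrow> 'a \<Rightarrow> real ^ 'n"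
where
  "mean_curvature c g h p =
     (1 / real CARD('m)) *\<^sub>R metric_trace (g c p) (second_fundamental_form c h p)"


section \<open>Convexity notions\<close>

definition substantial :: "'a topology \<Rightarrow> ('a \<Rightarrow> real ^ 'n::finite) \<Rightarrow> bool" where
  "substantial M h \<longleftrightarrow> \<not> (\<exists>S. affine S \<and> S \<noteq> UNIV \<and> h ` topspace M \<subseteq> S)"

definition supporting_hyperplane ::
  "(real ^ 'n::finite) set \<Rightarrow> real ^ 'n \<Rightarrow> (real ^ 'n) set \<Rightarrow> bool" where
  "supporting_hyperplane C p H \<longleftrightarrow>
     (\<exists>a b. a \<noteq> 0 \<and> H = {x. a \<bullet> x = b} \<and> p \<in> H \<and>
        (C \<subseteq> {x. a \<bullet> x \<le> b} \<or> C \<subseteq> {x. a \<bullet> x \<ge> b}))"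

definition normal_line :: "(real ^ 'n::finite) set \<Rightarrow> (real ^ 'n) set" where
  "normal_line H = {v. \<forall>x\<in>H. \<forall>y\<in>H. v \<bullet> (x - y) = 0}"

text \<open>Linear independence of the unit normals is that of a family, hence the injectivity. Each
  unit normal is determined up to sign, so it does not matter which ones are taken.\<close>

definition general_position :: "'i set \<Rightarrow> ('i \<Rightarrow> (real ^ 'n::finite) set) \<Rightarrow> bool" where
  "general_position I H \<longleftrightarrow>
     (\<forall>\<nu>. (\<forall>i\<in>I. \<nu> i \<in> normal_line (H i) \<and> norm (\<nu> i) = 1) \<longrightarrow>
        inj_on \<nu> I \<and> independent (\<nu> ` I))"

end

theory Submission
  imports Defs
begin

text \<open>The height functions \<open>x \<mapsto> \<langle>h x - p\<^sub>o, e\<^sub>i\<rangle>\<close> are nonnegative on \<open>M\<close>. Writing \<open>p\<^sub>o\<close> as a convex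
  combination of points of \<open>h M\<close>, every point with positive weight lies on all the \<open>H\<^sub>i\<close>. If
  \<open>h q\<close> lies on all the \<open>H\<^sub>i\<close>, then every height function has a minimum at \<open>q\<close>. Vanishing of the
  first derivatives makes the independent vectors \<open>e\<^sub>i\<close> normal to the \<open>m\<close>-dimensional image of the
  differential, so \<open>s \<le> n - m\<close>; nonnegativity of the Hessian, which is \<open>\<langle>\<sigma>(v, v), e\<^sub>i\<rangle>\<close>, gives the
  sign of the mean curvature after taking the trace.\<close>

section \<open>The second derivative test at a minimum\<close>

text \<open>A negative \<open>l\<close> would make \<open>\<phi>'\<close> negative just to the right
  of 0, and the mean value theorem would then push \<open>\<phi>\<close> below its minimum.\<close>

lemma second_derivative_nonneg_at_min_real:
  fixes \<phi> \<phi>' :: "real \<Rightarrow> real"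
  assumes "0 < r"
    and deriv: "\<And>t. \<bar>t\<bar> < r \<Longrightarrow> (\<phi> has_real_derivative \<phi>' t) (at t)"
    and min: "\<And>t. \<bar>t\<bar> < r \<Longrightarrow> \<phi> 0 \<le> \<phi> t"
    and "\<phi>' 0 = 0" and deriv2: "(\<phi>' has_real_derivative l) (at 0)"
  shows "0 \<le> l"
proof (rule ccontr)
  assume "\<not> 0 \<le> l"
  then obtain d where d: "d > 0" "\<And>t. 0 < t \<Longrightarrow> t < d \<Longrightarrow> \<phi>' t < 0"
    using DERIV_neg_dec_right[OF deriv2] \<open>\<phi>' 0 = 0\<close> by auto
  define t where "t = min d r / 2"
  have t: "0 < t" "t < d" "t < r"
    using d(1) \<open>0 < r\<close> by (auto simp: t_def)
  have "\<exists>z>0. z < t \<and> \<phi> t - \<phi> 0 = (t - 0) * \<phi>' z"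
    by (rule MVT2[OF t(1)]) (use t in \<open>auto intro!: deriv\<close>)
  then obtain z where z: "0 < z" "z < t" "\<phi> t - \<phi> 0 = t * \<phi>' z"
    by auto
  have "\<phi>' z < 0"
    using z t d(2) by auto
  with z t have "\<phi> t < \<phi> 0"
    by (smt (verit) mult_pos_neg)
  with min[of t] t show False
    by simp
qed

text \<open>Restriction to the line through \<open>x\<close> in direction \<open>v\<close> reduces
  this to one variable. \<open>F''\<close> differentiates the first derivative along the fixed
  vector \<open>v\<close>, in the same way as \<open>second_fundamental_form\<close>.\<close>

lemma second_derivative_nonneg_at_min:
  fixes F :: "'a::euclidean_space \<Rightarrow> real"
  assumes "open S" "x \<in> S"
    and deriv: "\<And>y. y \<in> S \<Longrightarrow> (F has_derivative F' y) (at y)"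
    and min: "\<And>y. y \<in> S \<Longrightarrow> F x \<le> F y"
    and deriv2: "((\<lambda>y. F' y v) has_derivative F'') (at x)"
  shows "0 \<le> F'' v"
proof (cases "v = 0")
  case True
  then show ?thesis
    using has_derivative_linear[OF deriv2] by (simp add: linear_0)
next
  case False
  from \<open>open S\<close> \<open>x \<in> S\<close> obtain \<epsilon> where \<epsilon>: "\<epsilon> > 0" "ball x \<epsilon> \<subseteq> S"
    by (meson open_contains_ball)
  \<comment> \<open>Parameters below \<open>r\<close> keep the line inside the ball; this quotient
    is why \<open>v = 0\<close> was split off.\<close>
  define r where "r = \<epsilon> / norm v"
  have inS: "x + t *\<^sub>R v \<in> S" if "\<bar>t\<bar> < r" for t
  proof -
    have "x + t *\<^sub>R v \<in> ball x \<epsilon>"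
      using that False by (simp add: r_def dist_norm field_simps)
    then show ?thesis
      using \<epsilon>(2) by blast
  qed
  have line: "((\<lambda>t. x + t *\<^sub>R v) has_derivative (\<lambda>t. t *\<^sub>R v)) (at t)" for t
    by (auto intro!: derivative_eq_intros)
  show ?thesis
  proof (rule second_derivative_nonneg_at_min_real[of r "\<lambda>t. F (x + t *\<^sub>R v)" "\<lambda>t. F' (x + t *\<^sub>R v) v"])
    show "0 < r"
      using \<epsilon>(1) False by (simp add: r_def)
    show "((\<lambda>t. F (x + t *\<^sub>R v)) has_real_derivative F' (x + t *\<^sub>R v) v) (at t)" if "\<bar>t\<bar> < r" for t
    proof -
      have "((\<lambda>t. F (x + t *\<^sub>R v)) has_derivative (\<lambda>u. F' (x + t *\<^sub>R v) (u *\<^sub>R v))) (at t)"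
        using has_derivative_compose[OF line deriv[OF inS[OF that]]] .
      moreover have "(\<lambda>u. F' (x + t *\<^sub>R v) (u *\<^sub>R v)) = (*) (F' (x + t *\<^sub>R v) v)"
        using has_derivative_linear[OF deriv[OF inS[OF that]]]
        by (auto simp: linear_cmul mult.commute)
      ultimately show ?thesis
        by (simp add: has_field_derivative_def)
    qed
    show "F (x + 0 *\<^sub>R v) \<le> F (x + t *\<^sub>R v)" if "\<bar>t\<bar> < r" for t
      using min inS[OF that] by simp
    show "F' (x + 0 *\<^sub>R v) v = 0"
      using differential_zero_maxmin[OF \<open>x \<in> S\<close> \<open>open S\<close> deriv] \<open>x \<in> S\<close> min by simp
    have "((\<lambda>t. F' (x + t *\<^sub>R v) v) has_derivative (\<lambda>u. F'' (u *\<^sub>R v))) (at 0)"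
      using has_derivative_compose[OF line[of 0], of "\<lambda>y. F' y v" F''] deriv2 by simp
    moreover have "(\<lambda>u. F'' (u *\<^sub>R v)) = (*) (F'' v)"
      using has_derivative_linear[OF deriv2] by (auto simp: linear_cmul mult.commute)
    ultimately show "((\<lambda>t. F' (x + t *\<^sub>R v) v) has_real_derivative F'' v) (at 0)"
      by (simp add: has_field_derivative_def)
  qed
qed

section \<open>Second derivatives and normal components\<close>

text \<open>Linearity in \<open>u\<close> is that of a Frechet derivative. Linearity in
  \<open>v\<close> holds for the first derivative at every point of \<open>S\<close> and passes to
  its derivative at \<open>x\<close>.\<close>

lemma bilinear_second_derivative:
  fixes f :: "'a::euclidean_space \<Rightarrow> 'b::euclidean_space"
  assumes "open S" "x \<in> S"
    and diff: "\<And>y. y \<in> S \<Longrightarrow> f differentiable (at y)"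
    and diff2: "\<And>v. (\<lambda>y. frechet_derivative f (at y) v) differentiable (at x)"
  shows "bilinear (\<lambda>u v. frechet_derivative (\<lambda>y. frechet_derivative f (at y) v) (at x) u)"
proof -
  have lin: "linear (frechet_derivative f (at y))" if "y \<in> S" for y
    using diff[OF that] linear_frechet_derivative by blast
  have D2: "((\<lambda>y. frechet_derivative f (at y) v) has_derivative
      frechet_derivative (\<lambda>y. frechet_derivative f (at y) v) (at x)) (at x)" for v
    using diff2 frechet_derivative_works by blast
  \<comment> \<open>A derivative at \<open>x\<close> depends only on values near \<open>x\<close>,
    so agreement on the open set \<open>S\<close> and uniqueness of derivatives suffice.\<close>
  have transfer: "G = frechet_derivative (\<lambda>y. frechet_derivative f (at y) v) (at x)"
    if "(F has_derivative G) (at x)" "\<And>y. y \<in> S \<Longrightarrow> F y = frechet_derivative f (at y) v" for F G v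
    using has_derivative_transform_within_open[OF that(1) \<open>open S\<close> \<open>x \<in> S\<close> that(2)]
    by (rule frechet_derivative_at)
  show ?thesis
    unfolding bilinear_def
  proof (intro conjI allI)
    show "linear (frechet_derivative (\<lambda>y. frechet_derivative f (at y) v) (at x))" for v
      using diff2 linear_frechet_derivative by blast
    show "linear (\<lambda>v. frechet_derivative (\<lambda>y. frechet_derivative f (at y) v) (at x) u)" for u
    proof (rule linearI)
      fix v w :: 'a and c :: real
      show "frechet_derivative (\<lambda>y. frechet_derivative f (at y) (v + w)) (at x) u =
        frechet_derivative (\<lambda>y. frechet_derivative f (at y) v) (at x) u +
        frechet_derivative (\<lambda>y. frechet_derivative f (at y) w) (at x) u"
        using fun_cong[OF transfer[OF has_derivative_add[OF D2[of v] D2[of w]], of "v + w"], of u]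
        by (simp add: linear_add lin)
      show "frechet_derivative (\<lambda>y. frechet_derivative f (at y) (c *\<^sub>R v)) (at x) u =
        c *\<^sub>R frechet_derivative (\<lambda>y. frechet_derivative f (at y) v) (at x) u"
        using fun_cong[OF transfer[OF has_derivative_scaleR_right[OF D2[of v], of c], of "c *\<^sub>R v"], of u]
        by (simp add: linear_cmul lin)
    qed
  qed
qed

text \<open>A vector and its normal component differ by an element of \<open>T\<close>, which
  \<open>a\<close> annihilates. The orthogonal decomposition shows that the definite description
  denotes.\<close>

lemma normal_component_inner:
  assumes "subspace T" "a \<in> orthogonal_comp T"
  shows "normal_component T w \<bullet> a = w \<bullet> a"
proof -
  obtain y z where yz: "y \<in> span T" "\<And>u. u \<in> span T \<Longrightarrow> orthogonal z u" "w = y + z"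
    using orthogonal_subspace_decomp_exists[of T w] by metis
  have T: "span T = T"
    using assms(1) by (simp add: span_eq_iff)
  have "normal_component T w = z"
    unfolding normal_component_def
  proof (rule the_equality)
    show "z \<in> orthogonal_comp T \<and> w - z \<in> T"
      using yz T by (auto simp: orthogonal_comp_def orthogonal_commute)
    fix z' assume z': "z' \<in> orthogonal_comp T \<and> w - z' \<in> T"
    \<comment> \<open>The difference of two candidates is both tangent and normal, hence orthogonal
      to itself.\<close>
    have "z' - z \<in> T"
      using subspace_diff[OF assms(1), of y "w - z'"] yz T z' by (simp add: algebra_simps)
    then have "z \<bullet> (z' - z) = 0" "(z' - z) \<bullet> z' = 0"
      using z' yz(2) T by (simp_all add: orthogonal_comp_def orthogonal_def)
    then have "(z' - z) \<bullet> (z' - z) = 0"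
      by (simp add: inner_diff_right inner_commute)
    then show "z' = z"
      by simp
  qed
  moreover have "y \<bullet> a = 0"
    using assms(2) yz(1) T by (auto simp: orthogonal_comp_def orthogonal_def)
  ultimately show ?thesis
    using yz(3) by (simp add: inner_left_distrib)
qed

section \<open>Gram matrices and the metric trace\<close>

text \<open>\<open>matrix_inv\<close> is defined by choice, so an explicit inverse has to be
  identified with it; for square matrices a left inverse is enough.\<close>

lemma matrix_inv_unique:
  fixes G Q :: "real ^ 'm::finite ^ 'm"
  assumes "Q ** G = mat 1"
  shows "matrix_inv G = Q"
proof -
  have "G ** Q = mat 1"
    using assms matrix_left_right_inverse by blast
  then have "\<exists>G'. G ** G' = mat 1 \<and> G' ** G = mat 1"
    using assms by blast
  then have "matrix_inv G ** G = mat 1"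
    unfolding matrix_inv_def by (rule someI2_ex) simp
  then show ?thesis
    by (metis \<open>G ** Q = mat 1\<close> matrix_mul_assoc matrix_mul_lid matrix_mul_rid)
qed

text \<open>The vectors \<open>w\<close> in \<open>W\<close> are the preimages under \<open>J\<close> of an orthonormal basis of \<open>range J\<close>.\<close>

lemma matrix_inv_gram_decomposition:
  fixes J :: "real ^ 'm::finite \<Rightarrow> real ^ 'n::finite"
  assumes "linear J" "inj J"
  obtains W where "finite W"
    and "matrix_inv (\<chi> k l. J (axis k 1) \<bullet> J (axis l 1)) = (\<chi> i j. \<Sum>w\<in>W. w $ i * w $ j)"
proof -
  obtain B where B: "B \<subseteq> range J" "pairwise orthogonal B" "\<And>x. x \<in> B \<Longrightarrow> norm x = 1"
      "independent B" "span B = range J"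
    using orthonormal_basis_subspace[of "range J"] assms(1)
    by (metis linear_subspace_image subspace_UNIV)
  have "finite B"
    using B(4) independent_imp_finite by blast
  define W where "W = inv J ` B"
  have J_inv: "J (inv J b) = b" if "b \<in> B" for b
    using that B(1) by (meson f_inv_into_f subsetD)
  have inj: "inj_on (inv J) B"
    by (metis J_inv inj_onI)
  define Q :: "real ^ 'm ^ 'm" where "Q = (\<chi> i j. \<Sum>w\<in>W. w $ i * w $ j)"
  define G :: "real ^ 'm ^ 'm" where "G = (\<chi> k l. J (axis k 1) \<bullet> J (axis l 1))"
  have expand: "J u = (\<Sum>i\<in>UNIV. u $ i *\<^sub>R J (axis i 1))" for u
  proof -
    have "J u = J (\<Sum>i\<in>UNIV. u $ i *\<^sub>R axis i 1)"
      using basis_expansion[of u] by (simp add: scalar_mult_eq_scaleR)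
    then show ?thesis
      by (simp add: linear_sum[OF assms(1)] linear_cmul[OF assms(1)])
  qed
  have "(Q ** G) $ i $ j = mat 1 $ i $ j" for i j
  proof -
    \<comment> \<open>Pulling the orthonormal expansion of \<open>J (axis j 1)\<close> back along
      \<open>J\<close> expands \<open>axis j 1\<close> in \<open>W\<close>. Its \<open>i\<close>-th
      coordinate is the entry of \<open>Q ** G\<close> computed below.\<close>
    have "J (\<Sum>b\<in>B. (J (axis j 1) \<bullet> b) *\<^sub>R inv J b) = (\<Sum>b\<in>B. (J (axis j 1) \<bullet> b) *\<^sub>R b)"
      by (simp add: linear_sum[OF assms(1)] linear_cmul[OF assms(1)] J_inv)
    also have "\<dots> = J (axis j 1)"
      using B \<open>finite B\<close> by (intro orthonormal_basis_expand) auto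
    finally have ax: "(\<Sum>b\<in>B. (J (axis j 1) \<bullet> b) *\<^sub>R inv J b) = axis j 1"
      using assms(2) by (simp add: inj_eq)
    have "(Q ** G) $ i $ j = (\<Sum>k\<in>UNIV. \<Sum>w\<in>W. w $ i * w $ k * (J (axis k 1) \<bullet> J (axis j 1)))"
      by (simp add: matrix_matrix_mult_def Q_def G_def sum_distrib_right)
    also have "\<dots> = (\<Sum>w\<in>W. \<Sum>k\<in>UNIV. w $ i * w $ k * (J (axis k 1) \<bullet> J (axis j 1)))"
      by (rule sum.swap)
    also have "\<dots> = (\<Sum>w\<in>W. w $ i * (J w \<bullet> J (axis j 1)))"
      by (subst (2) expand) (simp add: inner_sum_left sum_distrib_left mult.assoc)
    also have "\<dots> = (\<Sum>b\<in>B. inv J b $ i * (b \<bullet> J (axis j 1)))"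
      unfolding W_def by (subst sum.reindex[OF inj]) (simp add: J_inv)
    also have "\<dots> = (\<Sum>b\<in>B. (J (axis j 1) \<bullet> b) *\<^sub>R inv J b) $ i"
      by (simp add: inner_commute mult.commute)
    also have "\<dots> = mat 1 $ i $ j"
      unfolding ax by (simp add: axis_def mat_def)
    finally show ?thesis .
  qed
  then have "Q ** G = mat 1"
    by (simp add: vec_eq_iff)
  then show thesis
    using that[of W] \<open>finite B\<close> matrix_inv_unique[of Q G] unfolding W_def Q_def G_def by simp
qed

text \<open>With the inverse Gram matrix written as a sum of products \<open>w $ i * w $ j\<close>,
  the trace becomes the sum of the values \<open>B w w\<close> over a \<open>G\<close>-orthonormal
  basis, and each term pairs nonnegatively with \<open>a\<close>.\<close>

lemma metric_trace_inner_nonneg: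
  fixes J :: "real ^ 'm::finite \<Rightarrow> real ^ 'n::finite"
    and B :: "real ^ 'm \<Rightarrow> real ^ 'm \<Rightarrow> real ^ 'k::finite"
  assumes "linear J" "inj J" and G: "\<And>u v. G u v = J u \<bullet> J v"
    and bil: "bilinear (\<lambda>u v. B u v \<bullet> a)" and nonneg: "\<And>v. 0 \<le> B v v \<bullet> a"
  shows "0 \<le> metric_trace G B \<bullet> a"
proof -
  obtain W where W: "finite W"
    "matrix_inv (\<chi> k l. J (axis k 1) \<bullet> J (axis l 1)) = (\<chi> i j. \<Sum>w\<in>W. w $ i * w $ j)"
    by (rule matrix_inv_gram_decomposition[OF assms(1,2)])
  have expand: "B w w \<bullet> a = (\<Sum>i\<in>UNIV. \<Sum>j\<in>UNIV. w $ i * w $ j * (B (axis i 1) (axis j 1) \<bullet> a))" for w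
  proof -
    have w: "(\<Sum>i\<in>UNIV. w $ i *\<^sub>R axis i 1) = w"
      using basis_expansion[of w] by (simp add: scalar_mult_eq_scaleR)
    have "B w w \<bullet> a = B (\<Sum>i\<in>UNIV. w $ i *\<^sub>R axis i 1) (\<Sum>i\<in>UNIV. w $ i *\<^sub>R axis i 1) \<bullet> a"
      by (simp only: w)
    also have "\<dots> = (\<Sum>(i,j)\<in>UNIV \<times> UNIV. B (w $ i *\<^sub>R axis i 1) (w $ j *\<^sub>R axis j 1) \<bullet> a)"
      by (rule bilinear_sum[OF bil])
    also have "\<dots> = (\<Sum>i\<in>UNIV. \<Sum>j\<in>UNIV. w $ i * w $ j * (B (axis i 1) (axis j 1) \<bullet> a))"
      using bilinear_lmul[OF bil] bilinear_rmul[OF bil]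
      by (simp add: sum.cartesian_product mult.assoc mult.left_commute)
    finally show ?thesis .
  qed
  have "metric_trace G B \<bullet> a =
      (\<Sum>i\<in>UNIV. \<Sum>j\<in>UNIV. \<Sum>w\<in>W. w $ i * w $ j * (B (axis i 1) (axis j 1) \<bullet> a))"
    unfolding metric_trace_def G W(2) by (simp add: inner_sum_left sum_distrib_right)
  also have "\<dots> = (\<Sum>i\<in>UNIV. \<Sum>w\<in>W. \<Sum>j\<in>UNIV. w $ i * w $ j * (B (axis i 1) (axis j 1) \<bullet> a))"
    by (intro sum.cong refl sum.swap)
  also have "\<dots> = (\<Sum>w\<in>W. B w w \<bullet> a)"
    unfolding expand by (rule sum.swap)
  also have "\<dots> \<ge> 0"
    by (intro sum_nonneg nonneg)
  finally show ?thesis .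
qed

section \<open>Convex hulls, compactness and supporting hyperplanes\<close>

text \<open>The weighted heights of the points in a convex combination equal to \<open>p\<close> are
  nonnegative and sum to zero. The weights do not depend on \<open>i\<close>, so one point of
  nonzero weight serves all \<open>i\<close> at once.\<close>

lemma convex_hull_point_on_face:
  fixes S :: "'a::real_inner set"
  assumes "p \<in> convex hull S" and nonneg: "\<And>i x. i \<in> I \<Longrightarrow> x \<in> S \<Longrightarrow> 0 \<le> (x - p) \<bullet> e i"
  obtains x where "x \<in> S" "\<And>i. i \<in> I \<Longrightarrow> (x - p) \<bullet> e i = 0"
proof -
  obtain T u where T: "finite T" "T \<subseteq> S" "\<And>x. x \<in> T \<Longrightarrow> 0 \<le> u x" "sum u T = 1"
      "(\<Sum>x\<in>T. u x *\<^sub>R x) = p"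
    using assms(1) unfolding convex_hull_explicit by blast
  obtain x where x: "x \<in> T" "u x \<noteq> 0"
    using T(4) by (metis sum.neutral zero_neq_one)
  have "(x - p) \<bullet> e i = 0" if "i \<in> I" for i
  proof -
    have "(\<Sum>y\<in>T. u y * ((y - p) \<bullet> e i)) = ((\<Sum>y\<in>T. u y *\<^sub>R y) - sum u T *\<^sub>R p) \<bullet> e i"
      by (simp add: inner_sum_left inner_diff_left sum_subtractf right_diff_distrib sum_distrib_right)
    also have "\<dots> = 0"
      using T(4,5) by simp
    finally have "u x * ((x - p) \<bullet> e i) = 0"
      using sum_nonneg_eq_0_iff[OF T(1), of "\<lambda>y. u y * ((y - p) \<bullet> e i)"] T(2,3) nonneg[OF that] x(1)
      by (metis (no_types, lifting) mult_nonneg_nonneg subsetD)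
    with x(2) show ?thesis
      by simp
  qed
  with x(1) T(2) that show thesis
    by blast
qed

text \<open>On each chart domain \<open>h\<close> is its coordinate expression composed with the
  chart, hence continuous; the pieces glue. Compactness later makes the convex hull closed.\<close>

lemma compact_image_of_Ck_map:
  assumes "manifold k M A" "compact_space M" "Ck_map 2 A h"
  shows "compact (h ` topspace M)"
proof -
  have "continuous_map M euclidean h"
  proof (rule pasting_lemma[where I = A and T = fst and f = "\<lambda>_. h"])
    fix c assume c: "c \<in> A"
    then have chart: "is_chart M c"
      using assms(1) by (simp add: manifold_def)
    then show op: "openin M (fst c)"
      by (simp add: is_chart_def)
    have top: "topspace (subtopology M (fst c)) = fst c"
      using openin_subset[OF op] by (simp add: inf_absorb2)
    have hom: "homeomorphic_map (subtopology M (fst c)) (top_of_set (snd c ` fst c)) (snd c)"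
      using chart by (simp add: is_chart_def)
    then have inj: "inj_on (snd c) (fst c)"
      using homeomorphic_imp_injective_map top by metis
    have "continuous_on (snd c ` fst c) (h \<circ> chart_inv c)"
      using assms(3) c unfolding Ck_map_def Ck_on_def
      by (metis Ck_on_nat.simps(1) zero_enat_def zero_le)
    then have "continuous_map (top_of_set (snd c ` fst c)) euclidean (h \<circ> chart_inv c)"
      by simp
    then have "continuous_map (subtopology M (fst c)) euclidean ((h \<circ> chart_inv c) \<circ> snd c)"
      using continuous_map_compose homeomorphic_imp_continuous_map[OF hom] by blast
    then show "continuous_map (subtopology M (fst c)) euclidean h"
      by (rule continuous_map_eq) (use inj top in auto)
  next
    fix x assume "x \<in> topspace M"
    then have "x \<in> (\<Union>c\<in>A. fst c)"
      using assms(1) by (simp add: manifold_def)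
    then show "\<exists>j. j \<in> A \<and> x \<in> fst j \<and> h x = h x"
      by blast
  qed simp
  then show ?thesis
    using assms(2) image_compactin unfolding compact_space_def by fastforce
qed

text \<open>The normals of a hyperplane form a line, so the unit normal \<open>a\<close> is a
  nonzero multiple of the normal in the defining equation. Thus \<open>H\<close> is where the height
  in direction \<open>a\<close> vanishes.\<close>

lemma normal_line_of_supporting_hyperplane:
  assumes "supporting_hyperplane C p H" "a \<in> normal_line H" "norm a = 1"
  shows "H = {x. (x - p) \<bullet> a = 0}"
proof -
  obtain b \<beta> where b: "b \<noteq> 0" "H = {x. b \<bullet> x = \<beta>}" "p \<in> H"
    using assms(1) by (auto simp: supporting_hyperplane_def)
  \<comment> \<open>The part of \<open>a\<close> orthogonal to \<open>b\<close> is a direction of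
    \<open>H\<close>, so it is also orthogonal to \<open>a\<close>, and therefore zero.\<close>
  define w where "w = a - ((a \<bullet> b) / (b \<bullet> b)) *\<^sub>R b"
  have "b \<bullet> w = 0"
    using b(1) by (simp add: w_def inner_diff_right inner_commute)
  then have "p + w \<in> H"
    using b by (simp add: inner_add_right)
  then have "a \<bullet> w = 0"
    using assms(2) b(3) unfolding normal_line_def by force
  moreover have "w \<bullet> w = a \<bullet> w - ((a \<bullet> b) / (b \<bullet> b)) * (b \<bullet> w)"
    by (subst (1) w_def) (simp add: inner_diff_left)
  ultimately have "w = 0"
    using \<open>b \<bullet> w = 0\<close> by simp
  then obtain t where t: "a = t *\<^sub>R b"
    by (auto simp: w_def)
  then have "t \<noteq> 0"
    using assms(3) by auto
  with b t show ?thesis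
    by (auto simp: inner_diff_right inner_commute[of _ b])
qed

section \<open>Coordinate expressions of the immersion\<close>

lemma chart_expression_of_Ck2_map:
  assumes "manifold k M A" "Ck_map 2 A h" "c \<in> A"
  shows "open (snd c ` fst c)"
    and "fst c \<subseteq> topspace M"
    and "\<And>q. q \<in> fst c \<Longrightarrow> chart_inv c (snd c q) = q"
    and "\<And>x. x \<in> snd c ` fst c \<Longrightarrow> (h \<circ> chart_inv c) differentiable (at x)"
    and "\<And>x v. x \<in> snd c ` fst c \<Longrightarrow>
      (\<lambda>y. frechet_derivative (h \<circ> chart_inv c) (at y) v) differentiable (at x)"
proof -
  have chart: "is_chart M c"
    using assms(1,3) by (simp add: manifold_def)
  show "open (snd c ` fst c)"
    using chart by (simp add: is_chart_def)
  show sub: "fst c \<subseteq> topspace M"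
    using chart openin_subset unfolding is_chart_def by blast
  have "inj_on (snd c) (topspace (subtopology M (fst c)))"
    using chart homeomorphic_imp_injective_map unfolding is_chart_def by blast
  with sub have "inj_on (snd c) (fst c)"
    by (simp add: inf_absorb2)
  then show "chart_inv c (snd c q) = q" if "q \<in> fst c" for q
    using that by simp
  \<comment> \<open>Written with successors, order 2 unfolds to differentiability of the map and of
    its directional derivatives.\<close>
  have "Ck_on_nat (Suc (Suc 0)) (h \<circ> chart_inv c) (snd c ` fst c)"
    using assms(2,3) unfolding Ck_map_def Ck_on_def
    by (metis dual_order.refl numeral_2_eq_2 numeral_eq_enat)
  then show "\<And>x. x \<in> snd c ` fst c \<Longrightarrow> (h \<circ> chart_inv c) differentiable (at x)"
    and "\<And>x v. x \<in> snd c ` fst c \<Longrightarrow>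
      (\<lambda>y. frechet_derivative (h \<circ> chart_inv c) (at y) v) differentiable (at x)"
    by auto
qed

lemma linear_differential:
  assumes "manifold k M A" "Ck_map 2 A h" "c \<in> A" "q \<in> fst c"
  shows "linear (differential c h q)"
  unfolding differential_def
  using chart_expression_of_Ck2_map(4)[OF assms(1-3)] assms(4) linear_frechet_derivative by blast

section \<open>The height function in direction \<open>a\<close> at a contact point\<close>

context
  fixes M :: "'a topology" and A :: "('a, 'm::finite) chart set" and k :: enat
    and h :: "'a \<Rightarrow> real ^ 'n::finite" and a p :: "real ^ 'n" and c :: "('a, 'm) chart" and q :: 'a
  assumes mfd: "manifold k M A" and C2: "Ck_map 2 A h" and c: "c \<in> A" and q: "q \<in> fst c"
    and above: "\<And>x. x \<in> topspace M \<Longrightarrow> 0 \<le> (h x - p) \<bullet> a" and on: "(h q - p) \<bullet> a = 0"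
begin

lemma height_min:
  assumes "x \<in> snd c ` fst c"
  shows "(h \<circ> chart_inv c) (snd c q) \<bullet> a \<le> (h \<circ> chart_inv c) x \<bullet> a"
  using assms above on q chart_expression_of_Ck2_map(2,3)[OF mfd C2 c]
  by (fastforce simp: inner_diff_left)

lemma height_derivative:
  assumes "x \<in> snd c ` fst c"
  shows "((\<lambda>x. (h \<circ> chart_inv c) x \<bullet> a) has_derivative
    (\<lambda>v. frechet_derivative (h \<circ> chart_inv c) (at x) v \<bullet> a)) (at x)"
  using chart_expression_of_Ck2_map(4)[OF mfd C2 c assms] frechet_derivative_works
  by (intro has_derivative_inner_left) blast

text \<open>The height function is minimal at \<open>q\<close>, so its first derivative, the
  differential paired with \<open>a\<close>, vanishes there.\<close>

lemma normal_at_contact_point: "differential c h q v \<bullet> a = 0"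
proof -
  have q': "snd c q \<in> snd c ` fst c"
    using q by blast
  have "(\<lambda>v. frechet_derivative (h \<circ> chart_inv c) (at (snd c q)) v \<bullet> a) = (\<lambda>v. 0)"
    using differential_zero_maxmin[OF q' chart_expression_of_Ck2_map(1)[OF mfd C2 c] height_derivative[OF q']]
      height_min by blast
  then show ?thesis
    unfolding differential_def by meson
qed

text \<open>Since \<open>a\<close> is normal at \<open>q\<close>, pairing with it removes the
  projection in the second fundamental form and leaves the Hessian of the height function, which is
  nonnegative at the minimum.\<close>

lemma mean_curvature_inner_nonneg:
  assumes "immersion A h" "isometric A g h"
  shows "0 \<le> mean_curvature c g h q \<bullet> a"
proof -
  note chart = chart_expression_of_Ck2_map[OF mfd C2 c]
  define D2 where
    "D2 u v = frechet_derivative (\<lambda>x. frechet_derivative (h \<circ> chart_inv c) (at x) v) (at (snd c q)) u" for u v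
  have q': "snd c q \<in> snd c ` fst c"
    using q by blast
  have lin: "linear (differential c h q)"
    using linear_differential[OF mfd C2 c q] .
  have normal: "a \<in> orthogonal_comp (range (differential c h q))"
    using normal_at_contact_point by (auto simp: orthogonal_comp_def orthogonal_def inner_commute)
  have sff: "second_fundamental_form c h q u v \<bullet> a = D2 u v \<bullet> a" for u v
    unfolding second_fundamental_form_def D2_def
    using normal lin by (intro normal_component_inner) (auto simp: linear_subspace_image)
  have bil: "bilinear D2"
    unfolding D2_def using bilinear_second_derivative[OF chart(1) q' chart(4) chart(5)[OF q']] by blast
  have "bilinear (\<lambda>u v. D2 u v \<bullet> a)"
    using bil unfolding bilinear_def linear_iff by (simp add: inner_add_left)
  moreover have "0 \<le> D2 v v \<bullet> a" for v
  proof -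
    have "((\<lambda>y. frechet_derivative (h \<circ> chart_inv c) (at y) v \<bullet> a) has_derivative
      (\<lambda>u. D2 u v \<bullet> a)) (at (snd c q))"
      unfolding D2_def
      using chart(5)[OF q'] frechet_derivative_works by (intro has_derivative_inner_left) blast
    from second_derivative_nonneg_at_min[where F = "\<lambda>x. (h \<circ> chart_inv c) x \<bullet> a",
        OF chart(1) q' height_derivative height_min this]
    show ?thesis .
  qed
  \<comment> \<open>Being isometric turns \<open>g c q\<close> into the Gram form of the
    differential, as the trace lemma requires.\<close>
  ultimately have "0 \<le> metric_trace (g c q) (second_fundamental_form c h q) \<bullet> a"
    using assms c q
    by (intro metric_trace_inner_nonneg[OF lin]) (auto simp: sff immersion_def isometric_def)
  then show ?thesis
    by (simp add: mean_curvature_def)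
qed

end

section \<open>The codimension bound and the theorem\<close>

text \<open>Dimensions of orthogonal sets add, and injectivity gives \<open>range J\<close> the full
  dimension \<open>CARD('m)\<close>.\<close>

lemma card_normals_le_codimension:
  fixes J :: "real ^ 'm::finite \<Rightarrow> real ^ 'n::finite"
  assumes "linear J" "inj J" "independent E" "\<And>v a. a \<in> E \<Longrightarrow> J v \<bullet> a = 0"
  shows "card E + CARD('m) \<le> CARD('n)"
proof -
  have "dim (range J \<union> E) = dim (range J) + dim E"
    using assms(4) by (intro dim_orthogonal_sum) auto
  moreover have "dim (range J) = CARD('m)"
    using dim_image_eq[OF assms(1), of UNIV] assms(2) by simp
  moreover have "dim E = card E"
    using assms(3) by (rule dim_eq_card_independent)
  moreover have "dim (range J \<union> E) \<le> CARD('n)"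
    using dim_subset_UNIV[of "range J \<union> E"] by simp
  ultimately show ?thesis
    by linarith
qed

theorem theorem1p8:
  fixes M :: "'a topology"
    and A :: "('a, 'm::finite) chart set"
    and g :: "('a, 'm) metric_tensor"
    and h :: "'a \<Rightarrow> real ^ 'n::finite"
    and k :: enat
    and s :: nat
    and H :: "nat \<Rightarrow> (real ^ 'n) set"
    and e :: "nat \<Rightarrow> real ^ 'n"
    and p\<^sub>o :: "real ^ 'n"
  assumes "2 \<le> k" and "riemannian_manifold k M A g" and "compact_space M"
    and "Ck_map 2 A h" and "immersion A h" and "isometric A g h"
    and "substantial M h"
    and "p\<^sub>o \<in> frontier (convex hull (h ` topspace M))"
    and "\<And>i. i \<in> {1..s} \<Longrightarrow> supporting_hyperplane (convex hull (h ` topspace M)) p\<^sub>o (H i)"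
    and "general_position {1..s} H"
    and "\<And>i. i \<in> {1..s} \<Longrightarrow> e i \<in> normal_line (H i) \<and> norm (e i) = 1 \<and>
           (\<forall>x\<in>topspace M. (h x - p\<^sub>o) \<bullet> e i \<ge> 0)"
  shows "int s \<le> int CARD('n) - int CARD('m) \<and>
    h ` topspace M \<inter> (\<Inter>i\<in>{1..s}. H i) \<noteq> {} \<and>
    (\<forall>q\<in>topspace M. h q \<in> (\<Inter>i\<in>{1..s}. H i) \<longrightarrow>
       (\<forall>c\<in>A. q \<in> fst c \<longrightarrow> (\<forall>i\<in>{1..s}. mean_curvature c g h q \<bullet> e i \<ge> 0)))"
proof -
  have mfd: "manifold k M A"
    using assms(2) by (simp add: riemannian_manifold_def)
  have e: "e i \<in> normal_line (H i)" "norm (e i) = 1" "\<And>x. x \<in> topspace M \<Longrightarrow> 0 \<le> (h x - p\<^sub>o) \<bullet> e i"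
    if "i \<in> {1..s}" for i
    using assms(11)[OF that] by auto
  have H: "H i = {x. (x - p\<^sub>o) \<bullet> e i = 0}" if "i \<in> {1..s}" for i
    using normal_line_of_supporting_hyperplane[OF assms(9)[OF that] e(1,2)[OF that]] .
  have "compact (convex hull (h ` topspace M))"
    using compact_image_of_Ck_map[OF mfd assms(3,4)] by (rule compact_convex_hull)
  \<comment> \<open>A compact hull is closed, so it contains its frontier.\<close>
  then have "p\<^sub>o \<in> convex hull (h ` topspace M)"
    using assms(8) compact_imp_closed frontier_subset_closed by blast
  then obtain y where "y \<in> h ` topspace M" "\<And>i. i \<in> {1..s} \<Longrightarrow> (y - p\<^sub>o) \<bullet> e i = 0"
    by (rule convex_hull_point_on_face[where I = "{1..s}" and e = e]) (use e(3) in auto)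
  \<comment> \<open>For \<open>s = 0\<close> the height condition is empty, but a point
    \<open>q\<close> is still obtained; the dimension count there gives
    \<open>CARD('m) \<le> CARD('n)\<close>.\<close>
  then obtain q where q: "q \<in> topspace M" "\<And>i. i \<in> {1..s} \<Longrightarrow> (h q - p\<^sub>o) \<bullet> e i = 0"
    by auto
  have meet: "h ` topspace M \<inter> (\<Inter>i\<in>{1..s}. H i) \<noteq> {}"
    using q H by auto
  obtain c where c: "c \<in> A" "q \<in> fst c"
    using q(1) mfd unfolding manifold_def by blast
  \<comment> \<open>General position speaks of every choice of unit normals; here the choice is
    \<open>e\<close>. Injectivity lets the image of \<open>e\<close> be counted as
    \<open>s\<close>.\<close>
  have "inj_on e {1..s}" "independent (e ` {1..s})"
    using assms(10) e(1,2) unfolding general_position_def by blast+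
  moreover have "inj (differential c h q)"
    using assms(5) c by (simp add: immersion_def)
  ultimately have "card (e ` {1..s}) + CARD('m) \<le> CARD('n)"
    using linear_differential[OF mfd assms(4) c]
      normal_at_contact_point[OF mfd assms(4) c e(3) q(2)]
    by (intro card_normals_le_codimension[of "differential c h q"]) auto
  then have dim: "int s \<le> int CARD('n) - int CARD('m)"
    using \<open>inj_on e {1..s}\<close> by (simp add: card_image)
  \<comment> \<open>Here \<open>q\<close> and \<open>c\<close> are arbitrary again, no longer the
    contact point and chart chosen above.\<close>
  have "mean_curvature c g h q \<bullet> e i \<ge> 0"
    if "h q \<in> (\<Inter>i\<in>{1..s}. H i)" "c \<in> A" "q \<in> fst c" "i \<in> {1..s}" for q c i
    using mean_curvature_inner_nonneg[OF mfd assms(4) that(2,3) e(3)[OF that(4)] _ assms(5,6)]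
      that(1,4) H by blast
  with meet dim show ?thesis
    by blast
qed

end
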